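(* Let $k \ge 2$ and let $a_1, a_2, \dots, a_k$ be pairwise relatively prime positive integers. Put \[ \Pi := a_1 a_2 \cdots a_k, \qquad A_j := \frac{\Pi}{a_j} \ (1 \le j \le k), \qquad \Sigma := A_1 + A_2 + \dots + A_k , \] and let $g_s = g_s(A_1, A_2, \dots, A_k)$ and $g^*_s = g^*_s(A_1, A_2, \dots, A_k)$. Then for every integer $t \ge 1$, \[ g_{\binom{k+t-2}{k-1}} = (k+t-1)\Pi - \Sigma , \] and \[ g^*_s = (k+t-1)\Pi - \Sigma \quad \text{for every integer } s \text{ with } \binom{k+t-2}{k-1} \le s \le \binom{k+t-1}{k-1} - 1 . \] In words: the integer $(k+t-1)\Pi - \Sigma$ has exactly $\binom{k+t-2}{k-1}$ representations in terms of $A_1, \dots, A_k$, and every larger integer has at least $\binom{k+t-1}{k-1}$ representations in terms of $A_1, \dots, A_k$.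
   Context: Let $b_1, \dots, b_k$ be positive integers with $\gcd(b_1, \dots, b_k) = 1$. A representation of an integer $x$ in terms of $b_1, \dots, b_k$ is a $k$-tuple $(m_1, \dots, m_k) \in \mathbb{Z}_{\ge 0}^k$ with $x = m_1 b_1 + \dots + m_k b_k$; the integer $x$ has $s$ representations if there are exactly $s$ such tuples (so negative integers have $0$ representations). For an integer $s \ge 0$, $g_s(b_1, \dots, b_k)$ denotes the largest integer that has exactly $s$ representations in terms of $b_1, \dots, b_k$, and $g^*_s(b_1, \dots, b_k)$ denotes the largest integer that has at most $s$ representations in terms of $b_1, \dots, b_k$. *)

theory Defs
  imports Complex_Main "HOL-Library.FuncSet"
begin

(* A k-tuple (m_1, ..., m_k) of nonnegative integers is a function on {1..k} that is
   undefined elsewhere, so that distinct functions are distinct tuples. *)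
definition representations :: "nat \<Rightarrow> (nat \<Rightarrow> nat) \<Rightarrow> int \<Rightarrow> (nat \<Rightarrow> nat) set" where
  "representations k b x =
     {m \<in> {1..k} \<rightarrow>\<^sub>E UNIV. x = (\<Sum>j=1..k. int (m j) * int (b j))}"

(* For positive b the set is finite (see finite_representations), so card is the true count. *)
definition num_representations :: "nat \<Rightarrow> (nat \<Rightarrow> nat) \<Rightarrow> int \<Rightarrow> nat" where
  "num_representations k b x = card (representations k b x)"

(* Both values are meaningful only if the greatest element in question exists;
   otherwise GREATEST is unspecified. *)
definition g_exact :: "nat \<Rightarrow> (nat \<Rightarrow> nat) \<Rightarrow> nat \<Rightarrow> int" where
  "g_exact k b s = (GREATEST x. num_representations k b x = s)"

definition g_at_most :: "nat \<Rightarrow> (nat \<Rightarrow> nat) \<Rightarrow> nat \<Rightarrow> int" where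
  "g_at_most k b s = (GREATEST x. num_representations k b x \<le> s)"

lemma finite_representations:
  assumes "\<And>j. j \<in> {1..k} \<Longrightarrow> b j > 0"
  shows "finite (representations k b x)"
proof (rule finite_subset)
  show "representations k b x \<subseteq> {1..k} \<rightarrow>\<^sub>E {..nat x}"
  proof
    fix m assume m: "m \<in> representations k b x"
    have "m j \<le> nat x" if j: "j \<in> {1..k}" for j
    proof -
      have "int (m j) * 1 \<le> int (m j) * int (b j)"
        using assms[OF j] by (intro mult_left_mono) auto
      also have "\<dots> \<le> (\<Sum>j=1..k. int (m j) * int (b j))"
        using j by (intro member_le_sum) auto
      also have "\<dots> = x"
        using m by (simp add: representations_def)
      finally show ?thesis by simp
    qed
    then show "m \<in> {1..k} \<rightarrow>\<^sub>E {..nat x}"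
      using m by (auto simp: representations_def PiE_iff)
  qed
  show "finite ({1..k} \<rightarrow>\<^sub>E {..nat x})"
    by (intro finite_PiE) auto
qed

end

(* Writing x = \<Sum>j. r j * A j + q * P with 0 \<le> r j < a j, which is possible in exactly one way by
   the Chinese remainder theorem, the representations of x are the tuples r j + a j * c j with
   \<Sum>j. c j = q. So their number is the number of compositions of q into k nonnegative parts,
   which is positive only if q \<ge> 0. The number (k + t - 1) P - S has r j = a j - 1 for all j
   and q = t - 1, and no x with q < t exceeds it, since all r j are maximal. *)

theory Submission
  imports Defs "HOL-Number_Theory.Cong"
begin

section \<open>Counting compositions and recognising greatest elements\<close>

text \<open>Stars and bars, transferred from lists of length \<open>k\<close> with sum
  \<open>n\<close> by reading a tuple as the list of its values. For \<open>k = 0\<close> truncated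
  subtraction still gives the right count: 1 if \<open>n = 0\<close>, and 0 otherwise.\<close>

lemma card_compositions:
  "card {c \<in> {1..k} \<rightarrow>\<^sub>E UNIV. (\<Sum>j=1..k. c j) = (n::nat)} = (n + k - 1) choose n"
proof -
  have map_restrict: "map (\<lambda>j\<in>{Suc 0..k}. f j) [Suc 0..<Suc k] = map f [Suc 0..<Suc k]"
    for f :: "nat \<Rightarrow> nat"
    by (rule map_cong) auto
  have nth: "map (\<lambda>j. l ! (j - Suc 0)) [Suc 0..<Suc k] = l" if "length l = k" for l :: "nat list"
    using that by (intro nth_equalityI) (auto simp del: upt_Suc)
  have sum: "(\<Sum>j=Suc 0..k. c j) = sum_list (map c [Suc 0..<Suc k])" for c :: "nat \<Rightarrow> nat"
    by (simp add: interv_sum_list_conv_sum_set_nat atLeastLessThanSuc_atLeastAtMost del: upt_Suc)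
  have "bij_betw (\<lambda>c. map c [Suc 0..<Suc k])
      {c \<in> {Suc 0..k} \<rightarrow>\<^sub>E UNIV. (\<Sum>j=Suc 0..k. c j) = n} {l. length l = k \<and> sum_list l = n}"
  proof (rule bij_betw_byWitness[where f' = "\<lambda>l. \<lambda>j\<in>{Suc 0..k}. l ! (j - Suc 0)"])
    show "(\<lambda>l. \<lambda>j\<in>{Suc 0..k}. l ! (j - Suc 0)) ` {l. length l = k \<and> sum_list l = n}
        \<subseteq> {c \<in> {Suc 0..k} \<rightarrow>\<^sub>E UNIV. (\<Sum>j=Suc 0..k. c j) = n}"
    proof (intro image_subsetI)
      fix l :: "nat list" assume "l \<in> {l. length l = k \<and> sum_list l = n}"
      then show "(\<lambda>j\<in>{Suc 0..k}. l ! (j - Suc 0)) \<in> {c \<in> {Suc 0..k} \<rightarrow>\<^sub>E UNIV. (\<Sum>j=Suc 0..k. c j) = n}"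
        unfolding sum mem_Collect_eq map_restrict by (simp only: nth) auto
    qed
  qed (auto simp: sum map_restrict nth PiE_iff extensional_def fun_eq_iff simp del: upt_Suc)
  from bij_betw_same_card[OF this] show ?thesis
    by (simp add: card_length_sum_list)
qed

text \<open>The count beyond \<open>x\<close> is required to exceed \<open>s\<close>, not merely to
  differ from it, so that one lower bound serves \<open>g_exact\<close> and \<open>g_at_most\<close>
  alike.\<close>

lemma g_exact_eqI:
  assumes "num_representations k b x = s" and "\<And>y. y > x \<Longrightarrow> s < num_representations k b y"
  shows "g_exact k b s = x"
  unfolding g_exact_def using assms
  by (intro Greatest_equality) (metis less_irrefl not_le)+

lemma g_at_most_eqI:
  assumes "num_representations k b x \<le> s" and "\<And>y. y > x \<Longrightarrow> s < num_representations k b y"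
  shows "g_at_most k b s = x"
  unfolding g_at_most_def using assms
  by (intro Greatest_equality) (metis not_le)+

text \<open>By Pascal's rule the difference is \<open>n choose (r - 1)\<close>, which is positive
  since \<open>r - 1 \<le> n\<close>.\<close>

lemma binomial_strict_mono_upper:
  assumes "0 < r" "r \<le> Suc n"
  shows "n choose r < Suc n choose r"
  using assms by (cases r) (simp_all add: zero_less_binomial)

section \<open>Divisibility and the Chinese remainder theorem for the \<open>A j\<close>\<close>

context
  fixes k P :: nat and a A :: "nat \<Rightarrow> nat"
  assumes pos: "\<And>j. j \<in> {1..k} \<Longrightarrow> a j > 0"
    and coprime: "pairwise (\<lambda>i j. coprime (a i) (a j)) {1..k}"
    and P_def: "P = (\<Prod>j=1..k. a j)"
    and A_def: "\<And>j. j \<in> {1..k} \<Longrightarrow> A j = P div a j"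
begin

lemma P_pos: "P > 0"
  unfolding P_def using pos by (intro prod_pos) auto

lemma A_eq:
  assumes "j \<in> {1..k}"
  shows "A j = (\<Prod>i\<in>{1..k} - {j}. a i)"
proof -
  have "P = a j * (\<Prod>i\<in>{1..k} - {j}. a i)"
    using assms by (simp add: P_def prod.remove)
  then show ?thesis
    using pos[OF assms] by (simp add: A_def[OF assms])
qed

lemma mult_A: "j \<in> {1..k} \<Longrightarrow> a j * A j = P"
  by (simp add: A_eq P_def prod.remove)

lemma coprime_A:
  assumes "j \<in> {1..k}"
  shows "coprime (A j) (a j)"
  unfolding A_eq[OF assms]
  using assms coprime by (intro prod_coprime_left) (simp add: pairwise_def)

lemma dvd_A: "j \<in> {1..k} \<Longrightarrow> i \<in> {1..k} \<Longrightarrow> i \<noteq> j \<Longrightarrow> a j dvd A i"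
  by (auto simp: A_eq intro!: dvd_prodI)

text \<open>Every \<open>A i\<close> with \<open>i \<noteq> j\<close> contains the factor
  \<open>a j\<close>, so only the \<open>j\<close>-th term survives modulo
  \<open>a j\<close>.\<close>

lemma sum_cong_term:
  assumes j: "j \<in> {1..k}"
  shows "[(\<Sum>i=1..k. f i * int (A i)) = f j * int (A j)] (mod int (a j))"
proof -
  have "(\<Sum>i=1..k. f i * int (A i)) =
      f j * int (A j) + (\<Sum>i\<in>{1..k} - {j}. f i * int (A i))"
    using j by (simp add: sum.remove)
  moreover have "int (a j) dvd (\<Sum>i\<in>{1..k} - {j}. f i * int (A i))"
    using j dvd_A by (intro dvd_sum dvd_mult) auto
  ultimately show ?thesis
    by (simp add: cong_iff_dvd_diff)
qed

lemma P_dvd: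
  assumes "\<And>j. j \<in> {1..k} \<Longrightarrow> int (a j) dvd x"
  shows "int P dvd x"
proof -
  have "[x = 0] (mod (\<Prod>j=1..k. int (a j)))"
    using assms coprime
    by (intro cong_cong_prod_coprime) (auto simp: cong_0_iff pairwise_def)
  then show ?thesis
    by (simp add: P_def cong_0_iff)
qed

lemma decomposition:
  "\<exists>r q. (\<forall>j\<in>{1..k}. r j < a j) \<and> x = (\<Sum>j=1..k. int (r j) * int (A j)) + q * int P"
proof -
  have "\<exists>r < a j. [int r * int (A j) = x] (mod int (a j))" if j: "j \<in> {1..k}" for j
  proof -
    \<comment> \<open>\<open>y\<close> is an inverse of \<open>A j\<close> modulo
      \<open>a j\<close>, so the residue sought is that of \<open>x * y\<close>.\<close>
    obtain y where y: "[int (A j) * y = 1] (mod int (a j))"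
      using coprime_A[OF j] cong_solve_coprime_int[of "int (A j)" "int (a j)"] by auto
    define r where "r = nat ((x * y) mod int (a j))"
    have r: "int r = (x * y) mod int (a j)"
      using pos[OF j] by (simp add: r_def)
    have "[int r = x * y] (mod int (a j))"
      by (simp add: r cong_def)
    then have "[int r * int (A j) = x * y * int (A j)] (mod int (a j))"
      by (rule cong_scalar_right)
    also have "x * y * int (A j) = x * (int (A j) * y)"
      by simp
    also have "[\<dots> = x * 1] (mod int (a j))"
      by (rule cong_scalar_left[OF y])
    finally have "[int r * int (A j) = x] (mod int (a j))"
      by simp
    moreover have "int r < int (a j)"
      using pos[OF j] by (simp add: r)
    ultimately show ?thesis by auto
  qed
  then obtain r where r: "\<And>j. j \<in> {1..k} \<Longrightarrow> r j < a j"
    "\<And>j. j \<in> {1..k} \<Longrightarrow> [int (r j) * int (A j) = x] (mod int (a j))"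
    by metis
  have "int P dvd x - (\<Sum>j=1..k. int (r j) * int (A j))"
  proof (rule P_dvd)
    fix j assume j: "j \<in> {1..k}"
    show "int (a j) dvd x - (\<Sum>j=1..k. int (r j) * int (A j))"
      using cong_trans[OF sum_cong_term[OF j, of "\<lambda>j. int (r j)"] r(2)[OF j]]
      by (simp add: cong_iff_dvd_diff dvd_diff_commute)
  qed
  then obtain q where "x - (\<Sum>j=1..k. int (r j) * int (A j)) = int P * q" ..
  then have "x = (\<Sum>j=1..k. int (r j) * int (A j)) + q * int P"
    by (simp add: algebra_simps)
  with r(1) show ?thesis by blast
qed

section \<open>Representations as compositions of the quotient \<open>q\<close>\<close>

text \<open>Raising the \<open>j\<close>-th coefficient by \<open>a j\<close> adds
  \<open>a j * A j = P\<close>, the same amount for every \<open>j\<close>; hence only the sum of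
  the \<open>c j\<close> matters.\<close>

lemma sum_shift:
  "(\<Sum>j=1..k. int (r j + a j * c j) * int (A j)) =
    (\<Sum>j=1..k. int (r j) * int (A j)) + int (\<Sum>j=1..k. c j) * int P"
proof -
  have "(\<Sum>j=1..k. int (r j + a j * c j) * int (A j)) =
      (\<Sum>j=1..k. int (r j) * int (A j) + int (c j) * int (a j * A j))"
    by (intro sum.cong) (auto simp: algebra_simps)
  also have "\<dots> = (\<Sum>j=1..k. int (r j) * int (A j) + int (c j) * int P)"
    by (intro sum.cong) (auto simp: mult_A simp del: of_nat_mult)
  finally show ?thesis
    by (simp add: sum.distrib sum_distrib_right)
qed

text \<open>Modulo \<open>a j\<close> both expressions for \<open>x\<close> reduce to their
  \<open>j\<close>-th terms, and \<open>A j\<close> can be cancelled because it is coprime to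
  \<open>a j\<close>.\<close>

lemma residue_of_representation:
  assumes r: "\<And>j. j \<in> {1..k} \<Longrightarrow> r j < a j"
    and x: "x = (\<Sum>j=1..k. int (r j) * int (A j)) + q * int P"
    and m: "m \<in> representations k A x" and j: "j \<in> {1..k}"
  shows "m j mod a j = r j"
proof -
  have "[int (m j) * int (A j) = (\<Sum>i=1..k. int (m i) * int (A i))] (mod int (a j))"
    by (rule cong_sym[OF sum_cong_term[OF j]])
  also have "(\<Sum>i=1..k. int (m i) * int (A i)) = (\<Sum>j=1..k. int (r j) * int (A j)) + q * int P"
    using m unfolding x by (simp add: representations_def)
  also have "[\<dots> = (\<Sum>j=1..k. int (r j) * int (A j))] (mod int (a j))"
    by (simp add: cong_iff_dvd_diff flip: mult_A[OF j])
  also have "[(\<Sum>j=1..k. int (r j) * int (A j)) = int (r j) * int (A j)] (mod int (a j))"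
    by (rule sum_cong_term[OF j])
  finally have "[int (m j) = int (r j)] (mod int (a j))"
    using coprime_A[OF j] by (subst (asm) cong_mult_rcancel) auto
  then have "[m j = r j] (mod a j)"
    by (simp only: cong_int_iff)
  then show ?thesis
    using r[OF j] by (simp add: cong_def)
qed

text \<open>Adding \<open>a j * c j\<close> to \<open>r j\<close> and dividing by \<open>a j\<close>
  are inverse bijections. Here \<open>q\<close> is an integer; if it is negative, both sides are
  0.\<close>

lemma num_representations_eq_card:
  assumes r: "\<And>j. j \<in> {1..k} \<Longrightarrow> r j < a j"
    and x: "x = (\<Sum>j=1..k. int (r j) * int (A j)) + q * int P"
  shows "num_representations k A x =
    card {c \<in> {1..k} \<rightarrow>\<^sub>E UNIV. int (\<Sum>j=1..k. c j) = q}"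
proof -
  let ?f = "\<lambda>c. \<lambda>j\<in>{1..k}. r j + a j * c j"
  let ?g = "\<lambda>m. \<lambda>j\<in>{1..k}. m j div a j"
  let ?C = "{c \<in> {1..k} \<rightarrow>\<^sub>E UNIV. int (\<Sum>j=1..k. c j) = q}"
  have gf: "?g (?f c) = c" if "c \<in> ?C" for c
    using that r pos by (auto simp: fun_eq_iff PiE_iff extensional_def)
  \<comment> \<open>Since \<open>m j mod a j = r j\<close>, this is division with remainder of
    \<open>m j\<close> by \<open>a j\<close>.\<close>
  have fg: "?f (?g m) = m" if "m \<in> representations k A x" for m
  proof
    fix j
    show "?f (?g m) j = m j"
      using that residue_of_representation[OF r x that, of j, symmetric]
      by (auto simp: representations_def PiE_iff extensional_def)
  qed
  have f_sum: "(\<Sum>j=1..k. int (?f c j) * int (A j)) =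
      (\<Sum>j=1..k. int (r j) * int (A j)) + int (\<Sum>j=1..k. c j) * int P" for c
    unfolding sum_shift[symmetric] by (rule sum.cong) auto
  have "bij_betw ?f ?C (representations k A x)"
  proof (rule bij_betw_byWitness[where f' = ?g])
    show "\<forall>c\<in>?C. ?g (?f c) = c" "\<forall>m\<in>representations k A x. ?f (?g m) = m"
      using gf fg by blast+
    show "?f ` ?C \<subseteq> representations k A x"
    proof (intro subsetI, elim imageE)
      fix m c assume m: "m = ?f c" and c: "c \<in> ?C"
      show "m \<in> representations k A x"
        unfolding representations_def m mem_Collect_eq f_sum using c x by simp
    qed
    show "?g ` representations k A x \<subseteq> ?C"
    proof (intro subsetI, elim imageE)
      fix c m assume c: "c = ?g m" and m: "m \<in> representations k A x"
      have "x = (\<Sum>j=1..k. int (?f (?g m) j) * int (A j))"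
        unfolding fg[OF m] using m by (simp add: representations_def)
      then have "int (\<Sum>j=1..k. ?g m j) * int P = q * int P"
        using x f_sum[of "?g m"] by linarith
      then have "int (\<Sum>j=1..k. ?g m j) = q"
        using P_pos by simp
      then show "c \<in> ?C"
        unfolding c by (simp only: mem_Collect_eq) auto
    qed
  qed
  from bij_betw_same_card[OF this] show ?thesis
    by (simp add: num_representations_def)
qed

text \<open>The lower index \<open>k - 1\<close> does not depend on \<open>n\<close>, which makes
  the count visibly monotone in \<open>n\<close>.\<close>

lemma num_representations_eq:
  assumes "\<And>j. j \<in> {1..k} \<Longrightarrow> r j < a j"
    and "x = (\<Sum>j=1..k. int (r j) * int (A j)) + int n * int P" and "k > 0"
  shows "num_representations k A x = (n + k - 1) choose (k - 1)"
proof -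
  have "num_representations k A x = (n + k - 1) choose n"
    using num_representations_eq_card[OF assms(1,2)] by (simp only: of_nat_eq_iff card_compositions)
  also have "\<dots> = (n + k - 1) choose (k - 1)"
    using assms(3) by (subst binomial_symmetric) auto
  finally show ?thesis .
qed

section \<open>The extremal number and the bound beyond it\<close>

text \<open>Each term is \<open>(a j - 1) * A j = P - A j\<close>; this is where the subtracted sum
  of the \<open>A j\<close> in the extremal number comes from.\<close>

lemma sum_max_residues:
  "(\<Sum>j=1..k. int (a j - 1) * int (A j)) = int k * int P - int (\<Sum>j=1..k. A j)"
proof -
  have "(\<Sum>j=1..k. int (a j - 1) * int (A j)) = (\<Sum>j=1..k. int P - int (A j))"
  proof (rule sum.cong)
    fix j assume j: "j \<in> {1..k}"
    then have "int (a j - 1) = int (a j) - 1"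
      using pos by fastforce
    then show "int (a j - 1) * int (A j) = int P - int (A j)"
      using mult_A[OF j] by (simp add: algebra_simps flip: of_nat_mult)
  qed simp
  then show ?thesis
    by (simp add: sum_subtractf)
qed

lemma num_representations_extremal:
  assumes "k > 0" "t \<ge> 1"
  shows "num_representations k A ((int k + int t - 1) * int P - int (\<Sum>j=1..k. A j)) =
    (k + t - 2) choose (k - 1)"
proof -
  have *: "(int k + int t - 1) * int P - int (\<Sum>j=1..k. A j) =
      (\<Sum>j=1..k. int (a j - 1) * int (A j)) + int (t - 1) * int P"
    unfolding sum_max_residues using assms by (simp add: of_nat_diff algebra_simps)
  have "a j - 1 < a j" if "j \<in> {1..k}" for j
    using pos[OF that] by simp
  from num_representations_eq[OF this * assms(1)]
  have "num_representations k A ((int k + int t - 1) * int P - int (\<Sum>j=1..k. A j)) =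
      (t - 1 + k - 1) choose (k - 1)" .
  moreover have "t - 1 + k - 1 = k + t - 2"
    using assms by simp
  ultimately show ?thesis
    by simp
qed

text \<open>The residue part of \<open>x\<close> is at most the one with all residues maximal, so
  the excess of \<open>x\<close> must come from the quotient: \<open>q > t - 1\<close>. The binomial
  coefficient then grows with \<open>q\<close>.\<close>

lemma num_representations_ge:
  assumes "k > 0" and x: "x > (int k + int t - 1) * int P - int (\<Sum>j=1..k. A j)"
  shows "num_representations k A x \<ge> (k + t - 1) choose (k - 1)"
proof -
  obtain r q where r: "\<And>j. j \<in> {1..k} \<Longrightarrow> r j < a j"
    and eq: "x = (\<Sum>j=1..k. int (r j) * int (A j)) + q * int P"
    using decomposition[of x] by blast
  have "(\<Sum>j=1..k. int (r j) * int (A j)) \<le> (\<Sum>j=1..k. int (a j - 1) * int (A j))"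
  proof (intro sum_mono mult_right_mono)
    fix j assume "j \<in> {1..k}"
    from r[OF this] show "int (r j) \<le> int (a j - 1)"
      by linarith
  qed simp
  then have "(int t - 1) * int P < q * int P"
    using x eq unfolding sum_max_residues by (simp add: algebra_simps)
  then have "int t - 1 < q"
    by (simp add: mult_less_cancel_right)
  then have "0 \<le> q" "int t \<le> q"
    by linarith+
  then obtain n where n: "q = int n" "t \<le> n"
    by (metis nonneg_int_cases of_nat_le_iff)
  have "(k + t - 1) choose (k - 1) \<le> (n + k - 1) choose (k - 1)"
    using n(2) by (intro binomial_right_mono) auto
  also have "\<dots> = num_representations k A x"
    using num_representations_eq[of r x n] r eq n(1) assms(1) by simp
  finally show ?thesis .
qed

end

theorem theorem1:
  fixes k t P S :: nat and a A :: "nat \<Rightarrow> nat"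
  assumes "k \<ge> 2"
    and "\<And>j. j \<in> {1..k} \<Longrightarrow> a j > 0"
    and "pairwise (\<lambda>i j. coprime (a i) (a j)) {1..k}"
    and "P = (\<Prod>j=1..k. a j)"
    and "\<And>j. j \<in> {1..k} \<Longrightarrow> A j = P div a j"
    and "S = (\<Sum>j=1..k. A j)"
    and "t \<ge> 1"
  shows "g_exact k A ((k + t - 2) choose (k - 1)) = (int k + int t - 1) * int P - int S
    \<and> (\<forall>s. (k + t - 2) choose (k - 1) \<le> s \<and> s \<le> ((k + t - 1) choose (k - 1)) - 1 \<longrightarrow>
           g_at_most k A s = (int k + int t - 1) * int P - int S)
    \<and> num_representations k A ((int k + int t - 1) * int P - int S) = (k + t - 2) choose (k - 1)
    \<and> (\<forall>x > (int k + int t - 1) * int P - int S.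
           num_representations k A x \<ge> (k + t - 1) choose (k - 1))"
proof -
  let ?x = "(int k + int t - 1) * int P - int S"
  have exact: "num_representations k A ?x = (k + t - 2) choose (k - 1)"
    unfolding assms(6) using assms(1,7) by (intro num_representations_extremal[OF assms(2-5)]) auto
  have ge: "num_representations k A x \<ge> (k + t - 1) choose (k - 1)" if "x > ?x" for x
    using that assms(1) unfolding assms(6) by (intro num_representations_ge[OF assms(2-5)]) auto
  \<comment> \<open>Strictness needs \<open>k - 1 > 0\<close>, which is where
    \<open>k \<ge> 2\<close> enters.\<close>
  have "(k + t - 2) choose (k - 1) < Suc (k + t - 2) choose (k - 1)"
    using assms(1) by (intro binomial_strict_mono_upper) auto
  also have "Suc (k + t - 2) = k + t - 1"
    using assms(1) by simp
  finally have less: "(k + t - 2) choose (k - 1) < (k + t - 1) choose (k - 1)" .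
  have "g_exact k A ((k + t - 2) choose (k - 1)) = ?x"
    using less ge exact by (intro g_exact_eqI) (auto intro: less_le_trans)
  moreover have "g_at_most k A s = ?x"
    if "(k + t - 2) choose (k - 1) \<le> s" "s \<le> ((k + t - 1) choose (k - 1)) - 1" for s
  proof (rule g_at_most_eqI)
    \<comment> \<open>The bound on \<open>s\<close> uses truncated subtraction; it is strict because
      \<open>less\<close> makes the binomial coefficient positive.\<close>
    have "s < (k + t - 1) choose (k - 1)"
      using that less by linarith
    then show "s < num_representations k A y" if "y > ?x" for y
      using ge[OF that] by (rule less_le_trans)
  qed (simp only: exact that)
  ultimately show ?thesis
    using exact ge by blast
qed

end
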